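(* For every integer $n\ge 3$, $\eta(K^2_n)=\eta(K^{n-2}_n)=2n-6$.
   Context: All graphs are finite and simple. For $n,t\in\mathbb{N}$ with $1\le t\le n-1$, $K^t_n$ denotes the graph obtained from the complete graph $K_{n-1}$ by adding one new vertex adjacent to exactly $t$ of the $n-1$ old vertices. For a connected graph $G=(V,E)$, $d(a,b)$ is the length of a shortest path between $a$ and $b$. The Wiener index is $W(G)=\sum_{\{a,b\}\subseteq V} d(a,b)$ (sum over unordered pairs of vertices). The Szeged index is $\mathrm{Sz}(G)=\sum_{ab\in E} n_{ab}(a)\cdot n_{ab}(b)$, where $n_{ab}(a)$ is the number of vertices strictly closer to $a$ than to $b$, and $n_{ab}(b)$ is the number of vertices strictly closer to $b$ than to $a$. Define $\eta(G)=\mathrm{Sz}(G)-W(G)$. *)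

theory Defs
  imports "Graph_Theory.Graph_Theory"
begin

text \<open>
  A finite simple graph is a \<^locale>\<open>pair_graph\<close>: each edge \<open>{a, b}\<close> is stored as the two arcs
  \<open>(a, b)\<close> and \<open>(b, a)\<close>. Sums over edges therefore range over the doubletons in \<open>edges G\<close>, so that
  each edge is counted once.
\<close>

definition edges :: "'a pair_pre_digraph \<Rightarrow> 'a set set" where
  "edges G = {{a, b} | a b. (a, b) \<in> parcs G}"

text \<open>The common value \<open>f a b = f b a\<close> on the unordered pair \<open>e = {a, b}\<close>.\<close>

definition on_pair :: "('a \<Rightarrow> 'a \<Rightarrow> 'b) \<Rightarrow> 'a set \<Rightarrow> 'b" where
  "on_pair f e = (THE y. \<forall>a b. e = {a, b} \<longrightarrow> y = f a b)"

lemma on_pair_doubleton: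
  assumes "f a b = f b a"
  shows "on_pair f {a, b} = f a b"
  unfolding on_pair_def using assms
  by (intro the_equality) (auto simp: doubleton_eq_iff)

text \<open>Only meaningful when \<open>a\<close> and \<open>b\<close> lie in the same component.\<close>

definition gdist :: "'a pair_pre_digraph \<Rightarrow> 'a \<Rightarrow> 'a \<Rightarrow> nat" where
  "gdist G a b = (LEAST k. \<exists>p. pre_digraph.apath (with_proj G) a p b \<and> length p = k)"

definition closer :: "'a pair_pre_digraph \<Rightarrow> 'a \<Rightarrow> 'a \<Rightarrow> nat" where
  "closer G a b = card {x \<in> pverts G. gdist G x a < gdist G x b}"

definition Wiener :: "'a pair_pre_digraph \<Rightarrow> nat" where
  "Wiener G = (\<Sum>e | e \<subseteq> pverts G \<and> card e = 2. on_pair (gdist G) e)"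

definition Szeged :: "'a pair_pre_digraph \<Rightarrow> nat" where
  "Szeged G = (\<Sum>e\<in>edges G. on_pair (\<lambda>a b. closer G a b * closer G b a) e)"

definition eta :: "'a pair_pre_digraph \<Rightarrow> int" where
  "eta G = int (Szeged G) - int (Wiener G)"

definition add_vertex :: "'a \<Rightarrow> 'a set \<Rightarrow> 'a pair_pre_digraph \<Rightarrow> 'a pair_pre_digraph" where
  "add_vertex v T H =
    \<lparr> pverts = insert v (pverts H), parcs = parcs H \<union> {v} \<times> T \<union> T \<times> {v} \<rparr>"

text \<open>
  \<open>is_Knt n t G\<close>: \<open>G\<close> is a copy of the graph \<open>K\<^sup>t\<^sub>n\<close>. The graph is determined by \<open>n\<close> and \<open>t\<close> only up
  to isomorphism, so it is described by a predicate covering every choice of the vertices and of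
  the \<open>t\<close> neighbours; \<open>is_Knt_ex\<close> below provides an instance.
\<close>

definition is_Knt :: "nat \<Rightarrow> nat \<Rightarrow> 'a pair_pre_digraph \<Rightarrow> bool" where
  "is_Knt n t G \<longleftrightarrow> 1 \<le> t \<and> t \<le> n - 1 \<and>
    (\<exists>H v T. complete_digraph (n - 1) (with_proj H) \<and> v \<notin> pverts H \<and>
       T \<subseteq> pverts H \<and> card T = t \<and> G = add_vertex v T H)"

lemma is_Knt_ex:
  assumes "1 \<le> t" "t \<le> n - 1"
  shows "\<exists>G :: nat pair_pre_digraph. is_Knt n t G"
proof -
  define H :: "nat pair_pre_digraph" where
    "H = \<lparr> pverts = {..<n - 1}, parcs = {(a, b). a < n - 1 \<and> b < n - 1 \<and> a \<noteq> b} \<rparr>"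
  have "complete_digraph (n - 1) (with_proj H)"
    unfolding complete_digraph_pair_def by (auto simp: H_def)
  moreover have "n - 1 \<notin> pverts H" "{..<t} \<subseteq> pverts H" "card {..<t} = t"
    using assms by (auto simp: H_def)
  ultimately have "is_Knt n t (add_vertex (n - 1) {..<t} H)"
    unfolding is_Knt_def using assms by blast
  then show ?thesis ..
qed

lemma is_Knt_pair_graph:
  assumes "is_Knt n t G"
  shows "pair_graph G" and "card (pverts G) = n"
proof -
  obtain H v T where nt: "1 \<le> t" "t \<le> n - 1" and K: "complete_digraph (n - 1) (with_proj H)"
    and v: "v \<notin> pverts H" and T: "T \<subseteq> pverts H" and G: "G = add_vertex v T H"
    using assms unfolding is_Knt_def by blast
  have fin: "finite (pverts H)" and c: "card (pverts H) = n - 1"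
    and arcs: "parcs H = {(a, b). (a, b) \<in> pverts H \<times> pverts H \<and> a \<noteq> b}"
    using K unfolding complete_digraph_pair_def by auto
  show "card (pverts G) = n"
    using fin c v nt by (simp add: G add_vertex_def)
  have sub: "parcs G \<subseteq> pverts G \<times> pverts G"
    using arcs T by (auto simp: G add_vertex_def)
  moreover have finG: "finite (pverts G)" using fin by (simp add: G add_vertex_def)
  ultimately have "finite (parcs G)" by (meson finite_SigmaI finite_subset)
  moreover have "sym (parcs G)" using arcs by (auto simp: G add_vertex_def sym_def)
  moreover have "fst e \<noteq> snd e" if "e \<in> parcs G" for e
    using that arcs v T by (auto simp: G add_vertex_def)
  ultimately show "pair_graph G"
    using sub finG by unfold_locales (auto simp: symmetric_def)
qed

context pair_graph begin

lemma apath_swap: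
  assumes "apath a p b"
  shows "apath b (rev (map prod.swap p)) a"
proof -
  have walk: "awalk b (rev (map prod.swap p)) a \<and>
      pawalk_verts b (rev (map prod.swap p)) = rev (pawalk_verts a p)"
    if "awalk a p b" for a using that
  proof (induction p arbitrary: a)
    case Nil
    then show ?case by (auto simp: awalk_def)
  next
    case (Cons e p)
    obtain x y where e: "e = (x, y)" by (cases e)
    have [simp]: "x = a" and arc: "(a, y) \<in> parcs G" and w: "awalk y p b"
      using Cons.prems by (auto simp: awalk_Cons_iff e)
    have arc': "(y, a) \<in> parcs G"
      using arc pair_sym_arcs by (auto simp: symmetric_def dest: symD)
    let ?q = "rev (map prod.swap p)"
    have IH: "awalk b ?q y" "pawalk_verts b ?q = rev (pawalk_verts y p)"
      using Cons.IH[OF w] by auto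
    have "awalk y [(y, a)] a"
      using arc' by (auto simp: awalk_Cons_iff awalk_Nil_iff dest: in_arcsD1 in_arcsD2)
    with IH(1) have "awalk b (?q @ [(y, a)]) a"
      by (rule awalk_appendI)
    moreover have verts_app: "pawalk_verts u (q @ [(y, a)]) = pawalk_verts u q @ [a]"
      if "pcas u q y" for u q
      using that by (induction q arbitrary: u) auto
    have "pcas b ?q y" using IH(1) by (simp add: awalk_def)
    from verts_app[OF this] IH(2)
    have "pawalk_verts b (?q @ [(y, a)]) = rev (pawalk_verts y p) @ [a]" by simp
    ultimately show ?case by (simp add: e)
  qed
  with assms show ?thesis by (auto simp: apath_def)
qed

lemma gdist_commute: "gdist G a b = gdist G b a"
proof -
  have "(\<exists>p. apath a p b \<and> length p = k) \<longleftrightarrow> (\<exists>p. apath b p a \<and> length p = k)" for k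
    using apath_swap by (metis length_map length_rev)
  then show ?thesis unfolding gdist_def by simp
qed

end

end

theory Submission
  imports Defs
begin

text \<open>
  All distances in \<open>K\<^sup>t\<^sub>n\<close> are at most 2, and the pairs at distance 2 are exactly the \<open>s = n - 1 - t\<close>
  non-edges at the new vertex \<open>v\<close>. Hence \<open>\<eta>\<close> is the sum of \<open>closer a b * closer b a - 1\<close> over the
  edges, minus \<open>2 * s\<close>. The summand vanishes except on the \<open>t * s\<close> edges between neighbours and
  non-neighbours of \<open>v\<close>, where it is \<open>1\<close>, and on the \<open>t\<close> edges at \<open>v\<close>, where it is \<open>s\<close>. So
  \<open>\<eta> = 2 * s * (t - 1)\<close>, which takes the same value for \<open>(t, s) = (2, n - 3)\<close> and
  \<open>(t, s) = (n - 2, 1)\<close>.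
\<close>

context pair_graph begin

lemma gdist_refl:
  assumes "a \<in> pverts G"
  shows "gdist G a a = 0"
  unfolding gdist_def using assms
  by (intro Least_equality) (auto simp: apath_def awalk_Nil_iff intro!: exI[of _ "[]"])

lemma gdist_adjacent:
  assumes "(a, b) \<in> parcs G"
  shows "gdist G a b = 1"
  unfolding gdist_def
proof (rule Least_equality)
  have "a \<noteq> b" using assms no_loops by fastforce+
  moreover have "a \<in> pverts G" "b \<in> pverts G" using assms by (auto dest: in_arcsD1 in_arcsD2)
  ultimately have "apath a [(a, b)] b"
    using assms by (auto simp: apath_def awalk_Cons_iff awalk_Nil_iff)
  then show "\<exists>p. apath a p b \<and> length p = 1" by force
  fix k assume "\<exists>p. apath a p b \<and> length p = k"
  then obtain p where p: "apath a p b" "length p = k" by blast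
  have "p \<noteq> []" using p \<open>a \<noteq> b\<close> by (auto simp: apath_def awalk_Nil_iff)
  then show "1 \<le> k" using p by (cases p) auto
qed

text \<open>The path through \<open>c\<close> attains 2. A walk of length at most 1 is empty or a
  single arc, which would force \<open>a = b\<close> or adjacency.\<close>

lemma gdist_eq_2:
  assumes "(a, c) \<in> parcs G" "(c, b) \<in> parcs G" "(a, b) \<notin> parcs G" "a \<noteq> b"
  shows "gdist G a b = 2"
  unfolding gdist_def
proof (rule Least_equality)
  have "a \<noteq> c" "c \<noteq> b" using assms no_loops by fastforce+
  moreover have "a \<in> pverts G" "b \<in> pverts G" "c \<in> pverts G"
    using assms by (auto dest: in_arcsD1 in_arcsD2)
  ultimately have "apath a [(a, c), (c, b)] b"
    using assms by (auto simp: apath_def awalk_Cons_iff awalk_Nil_iff)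
  then show "\<exists>p. apath a p b \<and> length p = 2" by force
  fix k assume "\<exists>p. apath a p b \<and> length p = k"
  then obtain p where p: "awalk a p b" "length p = k" by (auto simp: apath_def)
  show "2 \<le> k"
  proof (rule ccontr)
    assume "\<not> 2 \<le> k"
    then consider "p = []" | e where "p = [e]"
      using p(2) by (cases p; cases "tl p") auto
    then show False
      using p(1) assms by cases (auto simp: awalk_Cons_iff awalk_Nil_iff)
  qed
qed

end

lemma eta_Knt:
  assumes "is_Knt n t G"
  shows "eta G = 2 * int (n - 1 - t) * (int t - 1)"
proof -
  interpret pair_graph G using is_Knt_pair_graph(1)[OF assms] .
  obtain K v T where t: "1 \<le> t" and K: "complete_digraph (n - 1) (with_proj K)"
    and v: "v \<notin> pverts K" and T: "T \<subseteq> pverts K" and card_T: "card T = t"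
    and G: "G = add_vertex v T K"
    using assms unfolding is_Knt_def by blast
  define S where "S = pverts K - T"
  have fin_K: "finite (pverts K)" and card_K: "card (pverts K) = n - 1"
    and arcs_K: "parcs K = {(a, b). (a, b) \<in> pverts K \<times> pverts K \<and> a \<noteq> b}"
    using K unfolding complete_digraph_pair_def by auto
  have fin: "finite T" "finite S" and disj: "T \<inter> S = {}" "v \<notin> T" "v \<notin> S"
    using fin_K T v finite_subset by (auto simp: S_def)
  have card_S: "card S = n - 1 - t"
    using fin T card_T card_K by (simp add: S_def card_Diff_subset)
  have verts: "pverts G = insert v (T \<union> S)"
    using T by (auto simp: G add_vertex_def S_def)
  have arcs: "(a, b) \<in> parcs G \<longleftrightarrow>
      a \<noteq> b \<and> (a \<in> T \<union> S \<and> b \<in> T \<union> S \<or> a = v \<and> b \<in> T \<or> a \<in> T \<and> b = v)" for a b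
    using T v by (auto simp: G add_vertex_def S_def arcs_K)
  \<comment> \<open>The only nonadjacent pairs of distinct vertices join \<open>v\<close> to
    \<open>S\<close>, and any neighbour \<open>c\<close> of \<open>v\<close> is a common neighbour
    of such a pair.\<close>
  obtain c where c: "c \<in> T" using t card_T by fastforce
  have dist: "gdist G a b = (if a = b then 0 else if (a, b) \<in> parcs G then 1 else 2)"
    if "a \<in> pverts G" "b \<in> pverts G" for a b
  proof -
    have "(a, c) \<in> parcs G \<and> (c, b) \<in> parcs G" if "a \<noteq> b" "(a, b) \<notin> parcs G"
      using that \<open>a \<in> pverts G\<close> \<open>b \<in> pverts G\<close> c disj unfolding arcs verts by auto
    then show ?thesis
      using that gdist_refl gdist_adjacent gdist_eq_2 by auto
  qed
  \<comment> \<open>With distances limited to 0, 1, 2, being strictly closer to \<open>a\<close>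
    means either equality with \<open>a\<close> or distance 1 from \<open>a\<close> and 2 from
    \<open>b\<close>.\<close>
  have closer: "closer G a b = card {x \<in> pverts G. x = a \<or> x \<noteq> b \<and> (x, a) \<in> parcs G \<and> (x, b) \<notin> parcs G}"
    if "(a, b) \<in> parcs G" for a b
  proof -
    have "a \<in> pverts G" "b \<in> pverts G" "a \<noteq> b" using that by (auto simp: arcs verts)
    then show ?thesis unfolding closer_def
      by (intro arg_cong[where f = card]) (auto simp: dist split: if_splits)
  qed
  define f where "f a b = closer G a b * closer G b a" for a b
  have f_commute: "f a b = f b a" for a b by (simp add: f_def)
  \<comment> \<open>Apart from each other, \<open>a\<close> and \<open>b\<close> have the same
    neighbours, so each is closer only to itself; likewise inside \<open>S\<close>.\<close>
  have f_TT: "f a b = 1" if "a \<in> T" "b \<in> T" "a \<noteq> b" for a b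
  proof -
    have "closer G a b = 1" if "a \<in> T" "b \<in> T" "a \<noteq> b" for a b
    proof -
      have "{x \<in> pverts G. x = a \<or> x \<noteq> b \<and> (x, a) \<in> parcs G \<and> (x, b) \<notin> parcs G} = {a}"
        using that disj by (auto simp: arcs verts)
      then show ?thesis using that by (subst closer) (auto simp: arcs)
    qed
    then show ?thesis using that by (simp add: f_def)
  qed
  have f_SS: "f a b = 1" if "a \<in> S" "b \<in> S" "a \<noteq> b" for a b
  proof -
    have "closer G a b = 1" if "a \<in> S" "b \<in> S" "a \<noteq> b" for a b
    proof -
      have "{x \<in> pverts G. x = a \<or> x \<noteq> b \<and> (x, a) \<in> parcs G \<and> (x, b) \<notin> parcs G} = {a}"
        using that disj by (auto simp: arcs verts)
      then show ?thesis using that by (subst closer) (auto simp: arcs)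
    qed
    then show ?thesis using that by (simp add: f_def)
  qed
  \<comment> \<open>Only \<open>v\<close> tells \<open>a\<close> and \<open>b\<close> apart: it is
    adjacent to \<open>a\<close> but not to \<open>b\<close>.\<close>
  have f_TS: "f a b = 2" if "a \<in> T" "b \<in> S" for a b
  proof -
    have "{x \<in> pverts G. x = a \<or> x \<noteq> b \<and> (x, a) \<in> parcs G \<and> (x, b) \<notin> parcs G} = {a, v}"
      "{x \<in> pverts G. x = b \<or> x \<noteq> a \<and> (x, b) \<in> parcs G \<and> (x, a) \<notin> parcs G} = {b}"
      using that disj by (auto simp: arcs verts)
    moreover have "a \<noteq> v" "(a, b) \<in> parcs G" "(b, a) \<in> parcs G"
      using that disj by (auto simp: arcs)
    ultimately show ?thesis by (simp add: f_def closer)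
  qed
  \<comment> \<open>All of \<open>S\<close> is adjacent to \<open>a\<close> but not to
    \<open>v\<close>, while the rest of \<open>T\<close> is adjacent to both.\<close>
  have f_vT: "f v a = 1 + card S" if "a \<in> T" for a
  proof -
    have "{x \<in> pverts G. x = v \<or> x \<noteq> a \<and> (x, v) \<in> parcs G \<and> (x, a) \<notin> parcs G} = {v}"
      "{x \<in> pverts G. x = a \<or> x \<noteq> v \<and> (x, a) \<in> parcs G \<and> (x, v) \<notin> parcs G} = insert a S"
      using that disj by (auto simp: arcs verts)
    moreover have "a \<notin> S" "(v, a) \<in> parcs G" "(a, v) \<in> parcs G"
      using that disj by (auto simp: arcs)
    ultimately show ?thesis using fin by (simp add: f_def closer)
  qed

  define pair where "pair = (\<lambda>(a :: 'a, b). {a, b})"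
  \<comment> \<open>The excess of an edge: its Szeged term minus 1, the distance that it contributes
    to the Wiener index.\<close>
  define w where "w e = int (on_pair f e) - 1" for e
  have w_pair: "w {a, b} = int (f a b) - 1" for a b
    by (simp add: w_def on_pair_doubleton f_commute)
  have edges_sub: "edges G \<subseteq> Pow (pverts G)"
    by (auto simp: edges_def arcs verts)
  have fin_V: "finite (pverts G)" using fin by (simp add: verts)
  have fin_E: "finite (edges G)"
    using edges_sub fin_V finite_subset by blast

  have "(\<Sum>e\<in>edges G. w e) = (\<Sum>e\<in>pair ` (T \<times> S \<union> {v} \<times> T). w e)"
  proof (rule sum.mono_neutral_right[OF fin_E])
    have "(a, b) \<in> parcs G" if "(a, b) \<in> T \<times> S \<union> {v} \<times> T" for a b
      using that disj by (auto simp: arcs)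
    then show "pair ` (T \<times> S \<union> {v} \<times> T) \<subseteq> edges G"
      by (auto simp: pair_def edges_def)
    show "\<forall>e\<in>edges G - pair ` (T \<times> S \<union> {v} \<times> T). w e = 0"
    proof
      fix e assume e: "e \<in> edges G - pair ` (T \<times> S \<union> {v} \<times> T)"
      then obtain a b where ab: "e = {a, b}" "(a, b) \<in> parcs G" by (auto simp: edges_def)
      \<comment> \<open>Stated for doubletons because \<open>e\<close> may present its ends in
        either order; both orders are excluded below.\<close>
      have out: "e \<noteq> {x, y}" if "(x, y) \<in> T \<times> S \<union> {v} \<times> T" for x y
        using e that by (force simp: pair_def)
      have "a \<in> T \<and> b \<in> T \<or> a \<in> S \<and> b \<in> S" "a \<noteq> b"
        using ab out[of a b] out[of b a] by (auto simp: arcs insert_commute)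
      then show "w e = 0" using f_TT f_SS by (auto simp: ab w_pair)
    qed
  qed
  also have "\<dots> = (\<Sum>(a, b)\<in>T \<times> S \<union> {v} \<times> T. w {a, b})"
  proof (subst sum.reindex)
    \<comment> \<open>As \<open>{v}\<close>, \<open>T\<close> and \<open>S\<close> are pairwise
      disjoint, no doubleton arises from two of these ordered pairs.\<close>
    show "inj_on pair (T \<times> S \<union> {v} \<times> T)"
      using disj by (auto simp: inj_on_def pair_def doubleton_eq_iff)
  qed (simp add: pair_def case_prod_unfold)
  also have "\<dots> = (\<Sum>(a, b)\<in>T \<times> S. w {a, b}) + (\<Sum>(a, b)\<in>{v} \<times> T. w {a, b})"
    using fin disj by (intro sum.union_disjoint) auto
  also have "(\<Sum>(a, b)\<in>T \<times> S. w {a, b}) = (\<Sum>(a, b)\<in>T \<times> S. 1)"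
    by (intro sum.cong) (auto simp: w_pair f_TS)
  also have "(\<Sum>(a, b)\<in>{v} \<times> T. w {a, b}) = (\<Sum>(a, b)\<in>{v} \<times> T. int (card S))"
    by (intro sum.cong) (auto simp: w_pair f_vT)
  \<comment> \<open>Both kinds of edges contribute \<open>t * card S\<close>: the first as
    \<open>t * card S\<close> edges of excess 1, the second as \<open>t\<close> edges of excess
    \<open>card S\<close>.\<close>
  finally have sum_w: "(\<Sum>e\<in>edges G. w e) = 2 * int t * int (card S)"
    by (simp add: card_T card_cartesian_product case_prod_unfold)

  \<comment> \<open>The non-edges, each contributing distance 2 to the Wiener index.\<close>
  let ?N = "(\<lambda>x. {v, x}) ` S"
  have pairs: "{e. e \<subseteq> pverts G \<and> card e = 2} = edges G \<union> ?N"
  proof (intro set_eqI iffI)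
    fix e assume "e \<in> {e. e \<subseteq> pverts G \<and> card e = 2}"
    then obtain a b where "e = {a, b}" "a \<noteq> b" "a \<in> pverts G" "b \<in> pverts G"
      by (auto simp: card_2_iff)
    then show "e \<in> edges G \<union> ?N"
      using disj by (auto simp: edges_def arcs verts insert_commute)
  next
    fix e assume "e \<in> edges G \<union> ?N"
    then show "e \<in> {e. e \<subseteq> pverts G \<and> card e = 2}"
      using disj by (auto simp: edges_def arcs verts card_insert_if)
  qed
  have dist_pair: "on_pair (gdist G) {a, b} = gdist G a b" for a b
    by (simp add: on_pair_doubleton gdist_commute)
  have "Wiener G = (\<Sum>e\<in>edges G. on_pair (gdist G) e) + (\<Sum>e\<in>?N. on_pair (gdist G) e)"
    unfolding Wiener_def pairs using fin fin_E disj
    by (intro sum.union_disjoint) (auto simp: edges_def arcs doubleton_eq_iff)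
  also have "(\<Sum>e\<in>edges G. on_pair (gdist G) e) = (\<Sum>e\<in>edges G. 1)"
    by (intro sum.cong) (auto simp: edges_def dist_pair gdist_adjacent)
  also have "(\<Sum>e\<in>?N. on_pair (gdist G) e) = (\<Sum>e\<in>?N. 2)"
    using disj by (intro sum.cong) (auto simp: dist_pair dist verts arcs)
  also have "\<dots> = 2 * card S"
    using disj by (simp add: card_image inj_on_def doubleton_eq_iff)
  finally have W: "Wiener G = card (edges G) + 2 * card S" by simp
  \<comment> \<open>The ones add up to \<open>card (edges G)\<close>, which cancels against the same
    term in \<open>W\<close>.\<close>
  have "int (Szeged G) = (\<Sum>e\<in>edges G. w e + 1)"
    unfolding Szeged_def f_def[symmetric] by (simp add: w_def)
  also have "\<dots> = 2 * int t * int (card S) + int (card (edges G))"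
    by (simp add: sum.distrib sum_w)
  finally show ?thesis
    unfolding eta_def W by (simp add: card_S algebra_simps)
qed

theorem lemma11:
  fixes n :: nat and G :: "'a pair_pre_digraph" and H :: "'b pair_pre_digraph"
  assumes "n \<ge> 3"
    and "is_Knt n 2 G"
    and "is_Knt n (n - 2) H"
  shows "eta G = eta H \<and> eta H = 2 * int n - 6"
  \<comment> \<open>The bound on \<open>n\<close> keeps the natural subtractions exact:
    \<open>n - 1 - 2\<close> is a true difference and \<open>n - 1 - (n - 2)\<close> is 1.\<close>
  using eta_Knt[OF assms(2)] eta_Knt[OF assms(3)] assms(1)
  by (simp add: of_nat_diff)

end
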